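(* Let $k\ge1$, let $\beta_1,\ldots,\beta_k$ be negative real numbers, let $(\alpha_n)$ be a sequence of real numbers with $\alpha_n\to\infty$, and let $Z_n$ be the partition function of the directed exponential random graph model with outward-star parameters $\beta_p^{(n)}=\beta_p\alpha_n$, $p=1,\ldots,k$ (defined in the context). Then: (i) $\lim_{n\to\infty}(Z_n)^{1/n^2}=1$. (ii) If $\lim_{n\to\infty}ne^{\alpha_n\beta_1}=0$, then $\lim_{n\to\infty}(Z_n)^{1/n}=1$. (iii) If $\lim_{n\to\infty}ne^{\alpha_n\beta_1}=\lambda\in(0,\infty)$, then $\lim_{n\to\infty}(Z_n)^{1/n}=e^{\lambda}$. (iv) If $\lim_{n\to\infty}ne^{\alpha_n\beta_1}=0$ and $\lim_{n\to\infty}\frac{\alpha_n}{n}=0$, then $$\lim_{n\to\infty}\frac{\log Z_n}{n^2e^{\alpha_n\beta_1}}=1.$$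
   Context: Directed graphs $G_n$ on the vertex set $\{1,\ldots,n\}$, with loops allowed, are represented by matrices $X_n=(X_{ij})_{1\le i,j\le n}$ with $X_{ij}\in\{0,1\}$, where $X_{ij}=1$ if and only if there is a directed edge from $i$ to $j$. For $p\ge1$ the directed $p$-star homomorphism density is $$s_p(X_n)=n^{-p-1}\sum_{1\le i,j_1,\ldots,j_p\le n}X_{ij_1}X_{ij_2}\cdots X_{ij_p}=n^{-p-1}\sum_{i=1}^n\left(\sum_{j=1}^nX_{ij}\right)^p.$$ The partition function is $$Z_n=\sum_{X_n\in\{0,1\}^{n\times n}}\exp\left[n^2\sum_{p=1}^k\beta_p^{(n)}s_p(X_n)\right],\qquad \beta_p^{(n)}=\beta_p\alpha_n.$$ *)

theory Defs
  imports "HOL-Analysis.Analysis"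
begin

text \<open>
  A directed graph on \<open>{1..n}\<close>, loops allowed, is its 0-1 adjacency matrix. Using
  extensional functions gives each graph exactly one representative, so that sums over
  \<open>digraphs n\<close> have exactly \<open>2 ^ (n\<^sup>2)\<close> terms.
\<close>

definition digraphs :: "nat \<Rightarrow> (nat \<Rightarrow> nat \<Rightarrow> real) set" where
  "digraphs n = ({1..n} \<rightarrow>\<^sub>E ({1..n} \<rightarrow>\<^sub>E {0, 1}))"

text \<open>The tuple \<open>(j\<^sub>1, \<dots>, j\<^sub>p)\<close> is an extensional function \<open>j\<close> on \<open>{1..p}\<close>.\<close>

definition star_density :: "nat \<Rightarrow> nat \<Rightarrow> (nat \<Rightarrow> nat \<Rightarrow> real) \<Rightarrow> real" where
  "star_density n p X =
     (\<Sum>i\<in>{1..n}. \<Sum>j\<in>({1..p} \<rightarrow>\<^sub>E {1..n}). \<Prod>l\<in>{1..p}. X i (j l)) / real n ^ (p + 1)"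

lemma star_density_eq:
  "star_density n p X = (\<Sum>i\<in>{1..n}. (\<Sum>j\<in>{1..n}. X i j) ^ p) / real n ^ (p + 1)"
proof -
  have "(\<Sum>j\<in>({1..p} \<rightarrow>\<^sub>E {1..n}). \<Prod>l\<in>{1..p}. X i (j l)) = (\<Sum>j\<in>{1..n}. X i j) ^ p" for i
    using prod_sum_PiE[of "{1..p}" "\<lambda>_. {1..n}" "\<lambda>_ j. X i j"] by simp
  then show ?thesis
    by (simp add: star_density_def)
qed

definition partition_function :: "nat \<Rightarrow> nat \<Rightarrow> (nat \<Rightarrow> real) \<Rightarrow> real" where
  "partition_function k n b =
     (\<Sum>X\<in>digraphs n. exp (real n ^ 2 * (\<Sum>p = 1..k. b p * star_density n p X)))"

end

theory Submission
  imports Defs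
begin

text \<open>
  The Hamiltonian is a sum over rows that depends only on the row sums, so \<open>Z n = W n ^ n\<close>
  with \<open>W n = (\<Sum>i\<le>n. (n choose i) * x n ^ i * q n i)\<close>, where \<open>x n = exp (\<alpha> n * \<beta> 1)\<close> and
  \<open>q n i \<le> 1\<close> collects the terms with \<open>p \<ge> 2\<close>. Hence \<open>1 \<le> W n \<le> (1 + x n) ^ n\<close>, which gives
  (i), (ii) and the upper bound in (iv). If \<open>\<alpha> n / n\<close> vanishes, then \<open>q n i\<close> tends to 1 for each
  fixed \<open>i\<close>; the two terms \<open>i \<le> 1\<close> give the lower bound in (iv), and dominated convergence of
  the whole sum gives (iii), where \<open>\<alpha> n / n \<longlonglongrightarrow> 0\<close> is automatic because \<open>\<alpha> n\<close> grows like \<open>ln n\<close>.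
\<close>

section \<open>Factorisation of the partition function over rows\<close>

lemma sum_PiE_01_by_sum:
  fixes F :: "real \<Rightarrow> real"
  assumes "finite A"
  shows "(\<Sum>v\<in>(A \<rightarrow>\<^sub>E {0, 1}). F (\<Sum>j\<in>A. v j)) = (\<Sum>i\<le>card A. real (card A choose i) * F (real i))"
proof -
  \<comment> \<open>A 0-1 vector on \<open>A\<close> is the indicator of a subset \<open>B\<close>,
    with sum \<open>card B\<close>. \<open>restrict\<close> gives it the value
    \<open>undefined\<close> off \<open>A\<close>, as \<open>PiE\<close> demands, so
    \<open>?ind\<close> is a bijection from \<open>Pow A\<close>. Grouping subsets by cardinality
    then yields the binomial coefficients.\<close>
  let ?ind = "\<lambda>B. restrict (\<lambda>j. if j \<in> B then 1 else 0 :: real) A"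
  have inj: "inj_on ?ind (Pow A)"
  proof (rule inj_onI)
    fix B C assume "B \<in> Pow A" "C \<in> Pow A" and eq: "?ind B = ?ind C"
    have "j \<in> B \<longleftrightarrow> j \<in> C" if "j \<in> A" for j
      using fun_cong[OF eq, of j] that by (auto split: if_splits)
    with \<open>B \<in> Pow A\<close> \<open>C \<in> Pow A\<close> show "B = C" by blast
  qed
  have img: "?ind ` Pow A = (A \<rightarrow>\<^sub>E {0, 1})"
  proof
    show "?ind ` Pow A \<subseteq> (A \<rightarrow>\<^sub>E {0, 1})" by (auto split: if_splits)
    show "(A \<rightarrow>\<^sub>E {0, 1}) \<subseteq> ?ind ` Pow A"
    proof
      fix v :: "'a \<Rightarrow> real" assume v: "v \<in> (A \<rightarrow>\<^sub>E {0, 1})"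
      have "v = ?ind {j\<in>A. v j = 1}"
      proof
        fix j show "v j = ?ind {j\<in>A. v j = 1} j"
          using PiE_mem[OF v, of j] PiE_arb[OF v, of j] by auto
      qed
      then show "v \<in> ?ind ` Pow A" by blast
    qed
  qed
  have "(\<Sum>v\<in>(A \<rightarrow>\<^sub>E {0, 1}). F (\<Sum>j\<in>A. v j)) = (\<Sum>B\<in>Pow A. F (\<Sum>j\<in>A. ?ind B j))"
    unfolding img[symmetric] by (simp add: sum.reindex[OF inj])
  also have "\<dots> = (\<Sum>B\<in>Pow A. F (real (card B)))"
  proof (rule sum.cong[OF refl])
    fix B assume "B \<in> Pow A"
    then have "A \<inter> B = B" by blast
    then have "(\<Sum>j\<in>A. ?ind B j) = real (card B)"
      using assms by (simp flip: sum.inter_restrict)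
    then show "F (\<Sum>j\<in>A. ?ind B j) = F (real (card B))" by simp
  qed
  also have "\<dots> = (\<Sum>i\<le>card A. \<Sum>B\<in>{B \<in> Pow A. card B = i}. F (real (card B)))"
    by (rule sum.group[symmetric]) (use assms in \<open>auto intro: card_mono\<close>)
  also have "\<dots> = (\<Sum>i\<le>card A. real (card A choose i) * F (real i))"
    using n_subsets[OF assms] by (intro sum.cong) auto
  finally show ?thesis .
qed

lemma partition_function_eq_power:
  "partition_function k n b =
     (\<Sum>i\<le>n. real (n choose i) * exp (\<Sum>p = 1..k. b p * (real n * (real i / real n) ^ p))) ^ n"
proof -
  define F where "F d = exp (\<Sum>p = 1..k. b p * (real n * (d / real n) ^ p))" for d
  have "real n ^ 2 * (\<Sum>p = 1..k. b p * star_density n p X)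
      = (\<Sum>i\<in>{1..n}. \<Sum>p = 1..k. b p * (real n * ((\<Sum>j\<in>{1..n}. X i j) / real n) ^ p))" for X
  proof -
    have "real n ^ 2 * (b p * star_density n p X)
        = (\<Sum>i\<in>{1..n}. b p * (real n * ((\<Sum>j\<in>{1..n}. X i j) / real n) ^ p))" for p
    \<comment> \<open>For \<open>n = 0\<close> both sides are 0: the left by the factor
      \<open>real n ^ 2\<close>, the right as an empty sum.\<close>
    proof (cases "n = 0")
      case False
      then have scale: "real n ^ 2 * (c / real n ^ (p + 1)) = real n * (c / real n ^ p)" for c
        by (simp add: power2_eq_square)
      have "real n ^ 2 * (b p * star_density n p X)
          = b p * (\<Sum>i\<in>{1..n}. real n ^ 2 * ((\<Sum>j\<in>{1..n}. X i j) ^ p / real n ^ (p + 1)))"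
        unfolding star_density_eq sum_divide_distrib sum_distrib_left[symmetric]
        by (rule mult.left_commute)
      then show ?thesis
        unfolding scale by (simp add: power_divide sum_distrib_left)
    qed simp
    then have "real n ^ 2 * (\<Sum>p = 1..k. b p * star_density n p X)
        = (\<Sum>p = 1..k. \<Sum>i\<in>{1..n}. b p * (real n * ((\<Sum>j\<in>{1..n}. X i j) / real n) ^ p))"
      by (simp add: sum_distrib_left)
    then show ?thesis by (simp only: sum.swap[of _ "{1..n}"])
  qed
  then have "partition_function k n b
      = (\<Sum>X\<in>digraphs n. \<Prod>i\<in>{1..n}. F (\<Sum>j\<in>{1..n}. X i j))"
    by (simp add: partition_function_def F_def exp_sum)
  \<comment> \<open>Rows are chosen independently, so distributivity turns the sum of row products
    into a product of \<open>n\<close> identical row sums.\<close>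
  also have "\<dots> = (\<Prod>i\<in>{1..n}. \<Sum>v\<in>({1..n} \<rightarrow>\<^sub>E {0, 1}). F (\<Sum>j\<in>{1..n}. v j))"
    unfolding digraphs_def by (rule prod_sum_PiE[symmetric]) (auto intro: finite_PiE)
  also have "\<dots> = (\<Sum>i\<le>n. real (n choose i) * F (real i)) ^ n"
    by (simp add: sum_PiE_01_by_sum)
  finally show ?thesis by (simp add: F_def)
qed

section \<open>Asymptotics of binomial sums\<close>

lemma binomial_le_power_div_fact: "real (n choose i) \<le> real n ^ i / fact i"
proof -
  have "real (n choose i) * fact i \<le> real n ^ i"
    using binomial_fact_pow[of n i] by (metis of_nat_fact of_nat_le_iff of_nat_mult of_nat_power)
  then show ?thesis by (simp add: field_simps)
qed

text \<open>Up to the factor \<open>1 / fact i\<close>, the quotient is a product of the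
  \<open>i\<close> factors \<open>1 - l / n\<close>, a fixed number of factors each tending to
  1.\<close>

lemma binomial_div_power_tendsto: "(\<lambda>n. real (n choose i) / real n ^ i) \<longlonglongrightarrow> 1 / fact i"
proof -
  have "(\<lambda>n. (\<Prod>l = 0..<i. 1 - real l / real n) / fact i) \<longlonglongrightarrow> (\<Prod>l = 0..<i. 1 - 0) / fact i"
    by (intro tendsto_intros lim_const_over_n) auto
  moreover have "eventually (\<lambda>n. (\<Prod>l = 0..<i. 1 - real l / real n) / fact i
      = real (n choose i) / real n ^ i) sequentially"
    using eventually_gt_at_top[of 0]
  proof eventually_elim
    case (elim n)
    have "(\<Prod>l = 0..<i. 1 - real l / real n) = (\<Prod>l = 0..<i. (real n - real l) / real n)"
      using elim by (intro prod.cong) (auto simp: field_simps)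
    also have "\<dots> = (\<Prod>l = 0..<i. real n - real l) / real n ^ i"
      by (simp add: prod_dividef)
    finally show ?case
      by (simp add: binomial_gbinomial gbinomial_prod_rev)
  qed
  ultimately show ?thesis by (simp add: filterlim_cong)
qed

text \<open>Tannery's theorem: the \<open>i\<close>-th term tends to \<open>r ^ i / fact i\<close>,
  and for large \<open>n\<close> it is dominated by the summable
  \<open>(r + 1) ^ i / fact i\<close>. The weights only need to be bounded by 1 and to tend to 1 for
  each fixed \<open>i\<close>.\<close>

lemma weighted_binomial_sum_tendsto_exp:
  fixes x :: "nat \<Rightarrow> real" and q :: "nat \<Rightarrow> nat \<Rightarrow> real"
  assumes lim: "(\<lambda>n. real n * x n) \<longlonglongrightarrow> r"
    and x: "\<And>n. x n \<ge> 0"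
    and q: "eventually (\<lambda>n. \<forall>i. \<bar>q n i\<bar> \<le> 1) sequentially"
    and q_lim: "\<And>i. (\<lambda>n. q n i) \<longlonglongrightarrow> 1"
  shows "(\<lambda>n. \<Sum>i\<le>n. real (n choose i) * (x n ^ i * q n i)) \<longlonglongrightarrow> exp r"
proof -
  let ?a = "\<lambda>i n. real (n choose i) * (x n ^ i * q n i)"
  have r: "r \<ge> 0"
    by (rule tendsto_lowerbound[OF lim]) (simp_all add: x)
  have term_lim: "(\<lambda>n. ?a i n) \<longlonglongrightarrow> r ^ i /\<^sub>R fact i" for i
  proof -
    have "(\<lambda>n. real (n choose i) / real n ^ i * ((real n * x n) ^ i * q n i))
        \<longlonglongrightarrow> 1 / fact i * (r ^ i * 1)"
      by (intro tendsto_intros binomial_div_power_tendsto lim q_lim)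
    moreover have "eventually (\<lambda>n. real (n choose i) / real n ^ i * ((real n * x n) ^ i * q n i)
        = ?a i n) sequentially"
      using eventually_gt_at_top[of 0] by eventually_elim (simp add: power_mult_distrib)
    ultimately have "(\<lambda>n. ?a i n) \<longlonglongrightarrow> 1 / fact i * (r ^ i * 1)"
      by (rule Lim_transform_eventually)
    then show ?thesis by (simp add: divide_inverse)
  qed
  have "eventually (\<lambda>n. real n * x n < r + 1) sequentially"
    by (rule order_tendstoD(2)[OF lim]) simp
  with q have "eventually (\<lambda>n. \<forall>i. norm (?a i n) \<le> (r + 1) ^ i /\<^sub>R fact i) sequentially"
  proof eventually_elim
    case (elim n)
    show ?case
    proof
      fix i
      have "norm (?a i n) = real (n choose i) * x n ^ i * \<bar>q n i\<bar>"
        by (simp add: abs_mult x)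
      also have "\<dots> \<le> real n ^ i / fact i * x n ^ i * 1"
        using elim(1) by (intro mult_mono binomial_le_power_div_fact) (auto simp: x)
      also have "\<dots> = (real n * x n) ^ i / fact i"
        by (simp add: power_mult_distrib)
      also have "\<dots> \<le> (r + 1) ^ i / fact i"
        using elim(2) by (intro divide_right_mono power_mono) (auto simp: x)
      finally show "norm (?a i n) \<le> (r + 1) ^ i /\<^sub>R fact i"
        by (simp add: divide_inverse mult.commute)
    qed
  qed
  \<comment> \<open>Tannery's theorem asks for the bound along the product filter; since it holds
    for all \<open>i\<close> at once, the condition on \<open>i\<close> can be taken to be
    \<open>True\<close>.\<close>
  then have "eventually (\<lambda>(i, n). norm (?a i n) \<le> (r + 1) ^ i /\<^sub>R fact i)
      (at_top \<times>\<^sub>F sequentially)"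
    by (subst eventually_prod_filter) (use eventually_True in \<open>force\<close>)
  then have "(\<lambda>n. \<Sum>i. ?a i n) \<longlonglongrightarrow> (\<Sum>i. r ^ i /\<^sub>R fact i)"
    using tannerys_theorem[OF term_lim _ summable_exp_generic] by auto
  \<comment> \<open>Terms with \<open>i > n\<close> vanish because \<open>n choose i\<close>
    does.\<close>
  moreover have "(\<Sum>i. ?a i n) = (\<Sum>i\<le>n. ?a i n)" for n
    by (rule suminf_finite) auto
  ultimately show ?thesis by (simp add: exp_def)
qed

section \<open>Elementary facts on roots and logarithms\<close>

lemma power_powr_inverse:
  assumes "(w :: real) > 0" "n > 0"
  shows "(w ^ n) powr (1 / real n) = w"
  using assms by (simp add: powr_powr flip: powr_realpow)

text \<open>With \<open>t = y n * c n\<close>, divide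
  \<open>t - t^2 \<le> ln (1 + t) \<le> t\<close> by \<open>y n\<close>; the lower bound uses that
  \<open>t\<close> is eventually below 1. Positivity of \<open>y\<close> is asked only for
  \<open>n > 0\<close>, since the intended \<open>y n = n * x n\<close> vanishes at 0.\<close>

lemma ln_one_plus_over_tendsto:
  fixes y c :: "nat \<Rightarrow> real"
  assumes y: "y \<longlonglongrightarrow> 0" "\<And>n. n > 0 \<Longrightarrow> y n > 0"
    and c: "c \<longlonglongrightarrow> 1" "\<And>n. c n \<ge> 0"
  shows "(\<lambda>n. ln (1 + y n * c n) / y n) \<longlonglongrightarrow> 1"
proof (rule tendsto_sandwich)
  have yc: "(\<lambda>n. y n * c n) \<longlonglongrightarrow> 0"
    using tendsto_mult[OF y(1) c(1)] by simp
  show "(\<lambda>n. c n - y n * c n * c n) \<longlonglongrightarrow> 1"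
    using tendsto_diff[OF c(1) tendsto_mult[OF yc c(1)]] by simp
  have "eventually (\<lambda>n. y n * c n < 1) sequentially"
    by (rule order_tendstoD(2)[OF yc]) simp
  then show "eventually (\<lambda>n. c n - y n * c n * c n \<le> ln (1 + y n * c n) / y n) sequentially"
    using eventually_gt_at_top[of 0]
  proof eventually_elim
    case (elim n)
    then have "y n * c n - (y n * c n)\<^sup>2 \<le> ln (1 + y n * c n)"
      by (intro ln_one_plus_pos_lower_bound) (auto simp: y c less_imp_le)
    with y(2)[of n] elim(2) show ?case
      by (simp add: field_simps power2_eq_square)
  qed
  show "eventually (\<lambda>n. ln (1 + y n * c n) / y n \<le> c n) sequentially"
    using eventually_gt_at_top[of 0]
  proof eventually_elim
    case (elim n)
    have "ln (1 + y n * c n) \<le> y n * c n"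
      using y(2)[OF elim] c(2)[of n] by (intro ln_add_one_self_le_self) simp
    with y(2)[OF elim] show ?case by (simp add: field_simps)
  qed
qed (rule c)

theorem mainTheorem4:
  fixes k :: nat and \<beta> :: "nat \<Rightarrow> real" and \<alpha> :: "nat \<Rightarrow> real" and Z :: "nat \<Rightarrow> real"
  assumes "k \<ge> 1"
    and "\<And>p. p \<in> {1..k} \<Longrightarrow> \<beta> p < 0"
    and "filterlim \<alpha> at_top sequentially"
    and "\<And>n. Z n = partition_function k n (\<lambda>p. \<beta> p * \<alpha> n)"
  shows "((\<lambda>n. Z n powr (1 / real n ^ 2)) \<longlonglongrightarrow> 1)
    \<and> (((\<lambda>n. real n * exp (\<alpha> n * \<beta> 1)) \<longlonglongrightarrow> 0)
        \<longrightarrow> ((\<lambda>n. Z n powr (1 / real n)) \<longlonglongrightarrow> 1))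
    \<and> (\<forall>r>0. ((\<lambda>n. real n * exp (\<alpha> n * \<beta> 1)) \<longlonglongrightarrow> r)
        \<longrightarrow> ((\<lambda>n. Z n powr (1 / real n)) \<longlonglongrightarrow> exp r))
    \<and> (((\<lambda>n. real n * exp (\<alpha> n * \<beta> 1)) \<longlonglongrightarrow> 0) \<and> ((\<lambda>n. \<alpha> n / real n) \<longlonglongrightarrow> 0)
        \<longrightarrow> ((\<lambda>n. ln (Z n) / (real n ^ 2 * exp (\<alpha> n * \<beta> 1))) \<longlonglongrightarrow> 1))"
proof -
  have \<beta>1: "\<beta> 1 < 0" using assms(1,2) by simp
  define x where "x n = exp (\<alpha> n * \<beta> 1)" for n
  define q where "q n i = exp (\<Sum>p = 2..k. \<beta> p * \<alpha> n * (real n * (real i / real n) ^ p))" for n i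
  define W where "W n = (\<Sum>i\<le>n. real (n choose i) * (x n ^ i * q n i))" for n
  have x_pos: "x n > 0" for n by (simp add: x_def)
  have q_pos: "q n i > 0" for n i by (simp add: q_def)
  have q0: "q n 0 = 1" for n by (simp add: q_def power_0_left)
  have Z_eq: "Z n = W n ^ n" if "n > 0" for n
  proof -
    \<comment> \<open>The term \<open>p = 1\<close> reduces to
      \<open>i * (\<alpha> n * \<beta> 1)\<close>, whose exponential is \<open>x n ^ i\<close>;
      cancelling \<open>n\<close> here requires \<open>n > 0\<close>.\<close>
    have "(\<Sum>p = 1..k. \<beta> p * \<alpha> n * (real n * (real i / real n) ^ p))
        = real i * (\<alpha> n * \<beta> 1) + (\<Sum>p = 2..k. \<beta> p * \<alpha> n * (real n * (real i / real n) ^ p))" for i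
      using that assms(1) by (simp add: sum.atLeast_Suc_atMost numeral_2_eq_2)
    then show ?thesis
      by (simp add: assms(4) partition_function_eq_power W_def x_def q_def exp_add exp_of_nat_mult)
  qed
  have W_ge: "1 \<le> W n" for n
  proof -
    have "(\<Sum>i\<in>{0}. real (n choose i) * (x n ^ i * q n i)) \<le> W n"
      unfolding W_def by (intro sum_mono2) (auto simp: x_pos q_pos less_imp_le)
    then show ?thesis by (simp add: q0)
  qed
  have \<alpha>_ev: "eventually (\<lambda>n. \<alpha> n \<ge> 0) sequentially"
    using assms(3) by (auto simp: filterlim_at_top)
  \<comment> \<open>Every exponent in \<open>q\<close> has the sign of
    \<open>\<beta> p * \<alpha> n\<close>, which is nonpositive once
    \<open>\<alpha> n \<ge> 0\<close>.\<close>
  have q_le: "eventually (\<lambda>n. \<forall>i. \<bar>q n i\<bar> \<le> 1) sequentially"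
    using \<alpha>_ev
  proof eventually_elim
    case (elim n)
    have "\<beta> p * \<alpha> n * (real n * (real i / real n) ^ p) \<le> 0" if "p \<in> {2..k}" for i p
      using assms(2)[of p] that elim by (intro mult_nonpos_nonneg) auto
    then show ?case by (auto simp: q_def intro!: sum_nonpos)
  qed
  have W_le: "eventually (\<lambda>n. W n \<le> (1 + x n) ^ n) sequentially"
    using q_le
  proof eventually_elim
    case (elim n)
    \<comment> \<open>Replacing the weights by 1 leaves the binomial expansion of
      \<open>(1 + x n) ^ n\<close>.\<close>
    have "real (n choose i) * (x n ^ i * q n i) \<le> real (n choose i) * (x n ^ i * 1)" for i
      using elim x_pos[of n] by (intro mult_left_mono) (auto simp: abs_le_iff)
    then have "W n \<le> (\<Sum>i\<le>n. real (n choose i) * x n ^ i)"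
      unfolding W_def by (intro sum_mono) simp
    also have "\<dots> = (1 + x n) ^ n"
      using binomial_ring[of "x n" 1 n] by (simp add: add.commute)
    finally show ?case .
  qed
  have W_le_exp: "eventually (\<lambda>n. W n \<le> exp (real n * x n)) sequentially"
    using W_le
  proof eventually_elim
    case (elim n)
    have "(1 + x n) ^ n \<le> exp (x n) ^ n"
      using x_pos[of n] by (intro power_mono) (auto intro: less_imp_le)
    with elim show ?case by (simp add: exp_of_nat_mult)
  qed
  have Z_root: "eventually (\<lambda>n. Z n powr (1 / real n) = W n) sequentially"
    using eventually_gt_at_top[of 0]
  proof eventually_elim
    case (elim n)
    with W_ge[of n] show ?case by (simp add: Z_eq power_powr_inverse)
  qed
  have q_lim: "(\<lambda>n. q n i) \<longlonglongrightarrow> 1" if "(\<lambda>n. \<alpha> n / real n) \<longlonglongrightarrow> 0" for i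
  proof -
    have "(\<lambda>n. \<beta> p * \<alpha> n * (real n * (real i / real n) ^ p)) \<longlonglongrightarrow> 0" if p: "p \<in> {2..k}" for p
    proof -
      \<comment> \<open>Since \<open>p \<ge> 2\<close>, a factor \<open>\<alpha> n / n\<close>
        splits off and tends to 0, while the remaining power \<open>(1 / n) ^ (p - 2)\<close>
        converges, to 1 when \<open>p = 2\<close>.\<close>
      have "(\<lambda>n. \<beta> p * (\<alpha> n / real n) * (real i ^ p * (1 / real n) ^ (p - 2)))
          \<longlonglongrightarrow> \<beta> p * 0 * (real i ^ p * 0 ^ (p - 2))"
        by (intro tendsto_intros lim_const_over_n \<open>(\<lambda>n. \<alpha> n / real n) \<longlonglongrightarrow> 0\<close>)
      moreover obtain m where "p = m + 2"
        using p by (metis atLeastAtMost_iff le_add_diff_inverse2)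
      then have "\<beta> p * (\<alpha> n / real n) * (real i ^ p * (1 / real n) ^ (p - 2))
          = \<beta> p * \<alpha> n * (real n * (real i / real n) ^ p)" for n
        by (cases "n = 0") (simp_all add: field_simps)
      ultimately show ?thesis by simp
    qed
    then have "(\<lambda>n. q n i) \<longlonglongrightarrow> exp (\<Sum>p = 2..k. 0)"
      unfolding q_def by (intro tendsto_intros)
    then show ?thesis by simp
  qed

  have "(\<lambda>n. Z n powr (1 / real n ^ 2)) \<longlonglongrightarrow> 1"
  proof (rule tendsto_sandwich)
    have "filterlim (\<lambda>n. \<alpha> n * \<beta> 1) at_bot sequentially"
      using filterlim_tendsto_neg_mult_at_bot[OF tendsto_const \<beta>1 assms(3)]
      by (simp add: mult.commute)
    then have "x \<longlonglongrightarrow> 0"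
      unfolding x_def by (rule filterlim_compose[OF exp_at_bot])
    then have upper: "(\<lambda>n. 1 + x n) \<longlonglongrightarrow> 1"
      using tendsto_add[OF tendsto_const, of x 0 sequentially 1] by simp
    \<comment> \<open>One of the two roots undoes the power in \<open>Z n = W n ^ n\<close>; the
      other is applied to \<open>1 \<le> W n \<le> (1 + x n) ^ n\<close> and leaves the bounds 1 and
      \<open>1 + x n\<close>.\<close>
    have root: "Z n powr (1 / real n ^ 2) = W n powr (1 / real n)" if "n > 0" for n
    proof -
      have "Z n powr (1 / real n ^ 2) = (Z n powr (1 / real n)) powr (1 / real n)"
        by (simp add: powr_powr power2_eq_square)
      then show ?thesis
        using that W_ge[of n] by (simp add: Z_eq power_powr_inverse)
    qed
    show "eventually (\<lambda>n. 1 \<le> Z n powr (1 / real n ^ 2)) sequentially"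
      using eventually_gt_at_top[of 0]
      by eventually_elim (simp add: root W_ge ge_one_powr_ge_zero)
    show "eventually (\<lambda>n. Z n powr (1 / real n ^ 2) \<le> 1 + x n) sequentially"
      using W_le eventually_gt_at_top[of 0]
    proof eventually_elim
      case (elim n)
      have "W n powr (1 / real n) \<le> ((1 + x n) ^ n) powr (1 / real n)"
        using elim W_ge[of n] by (intro powr_mono2) auto
      with elim show ?case
        using x_pos[of n] by (simp add: root power_powr_inverse)
    qed
    show "(\<lambda>n. 1 + x n) \<longlonglongrightarrow> 1" by (rule upper)
  qed simp
  moreover have "(\<lambda>n. Z n powr (1 / real n)) \<longlonglongrightarrow> 1" if "(\<lambda>n. real n * x n) \<longlonglongrightarrow> 0"
  proof -
    have "W \<longlonglongrightarrow> 1"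
    proof (rule tendsto_sandwich)
      show "eventually (\<lambda>n. 1 \<le> W n) sequentially" by (simp add: W_ge)
      show "(\<lambda>n. exp (real n * x n)) \<longlonglongrightarrow> 1"
        using tendsto_exp[OF that] by simp
    qed (use W_le_exp in auto)
    then show ?thesis using Z_root by (simp add: filterlim_cong)
  qed
  moreover have "(\<lambda>n. Z n powr (1 / real n)) \<longlonglongrightarrow> exp r"
    if "r > 0" and lim: "(\<lambda>n. real n * x n) \<longlonglongrightarrow> r" for r
  proof -
    \<comment> \<open>Solving \<open>ln (n * x n) = ln n + \<alpha> n * \<beta> 1\<close> for
      \<open>\<alpha> n / n\<close> shows that it vanishes: \<open>ln (n * x n)\<close> converges to
      \<open>ln r\<close> because \<open>r > 0\<close>, and \<open>ln n / n\<close> tends to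
      0.\<close>
    have "(\<lambda>n. ln (real n) / real n) \<longlonglongrightarrow> 0"
      by (rule lim_ln_over_n)
    then have "(\<lambda>n. (ln (real n * x n) * (1 / real n) - ln (real n) / real n) / \<beta> 1)
        \<longlonglongrightarrow> (ln r * 0 - 0) / \<beta> 1"
      using \<open>r > 0\<close> \<beta>1 by (intro tendsto_intros lim lim_const_over_n) auto
    moreover have "eventually (\<lambda>n. (ln (real n * x n) * (1 / real n) - ln (real n) / real n) / \<beta> 1
        = \<alpha> n / real n) sequentially"
      using eventually_gt_at_top[of 0]
    proof eventually_elim
      case (elim n)
      then have "ln (real n * x n) = ln (real n) + \<alpha> n * \<beta> 1"
        by (simp add: ln_mult x_def)
      with elim \<beta>1 show ?case by (simp add: field_simps)
    qed
    ultimately have "(\<lambda>n. \<alpha> n / real n) \<longlonglongrightarrow> 0"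
      by (simp add: filterlim_cong)
    then have "W \<longlonglongrightarrow> exp r"
      unfolding W_def
      by (intro weighted_binomial_sum_tendsto_exp lim q_le q_lim) (simp add: x_pos less_imp_le)
    then show ?thesis using Z_root by (simp add: filterlim_cong)
  qed
  moreover have "(\<lambda>n. ln (Z n) / (real n ^ 2 * x n)) \<longlonglongrightarrow> 1"
    if lim: "(\<lambda>n. real n * x n) \<longlonglongrightarrow> 0" and "(\<lambda>n. \<alpha> n / real n) \<longlonglongrightarrow> 0"
  proof -
    \<comment> \<open>As \<open>ln (Z n) = n * ln (W n)\<close>, one factor \<open>n\<close> cancels
      and this is the required limit. The lower bound keeps the terms \<open>i = 0\<close> and
      \<open>i = 1\<close> of \<open>W n\<close>; the upper one is
      \<open>W n \<le> exp (n * x n)\<close>.\<close>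
    have "(\<lambda>n. ln (W n) / (real n * x n)) \<longlonglongrightarrow> 1"
    proof (rule tendsto_sandwich)
      show "(\<lambda>n. ln (1 + real n * x n * q n 1) / (real n * x n)) \<longlonglongrightarrow> 1"
        by (rule ln_one_plus_over_tendsto)
          (use lim q_lim[OF that(2)] x_pos q_pos in \<open>auto intro: less_imp_le\<close>)
      show "eventually (\<lambda>n. ln (1 + real n * x n * q n 1) / (real n * x n)
          \<le> ln (W n) / (real n * x n)) sequentially"
        using eventually_gt_at_top[of 0]
      proof eventually_elim
        case (elim n)
        have "(\<Sum>i\<in>{0, 1}. real (n choose i) * (x n ^ i * q n i)) \<le> W n"
          unfolding W_def using elim
          by (intro sum_mono2) (auto simp: x_pos q_pos less_imp_le)
        then have "1 + real n * x n * q n 1 \<le> W n"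
          by (simp add: q0 mult.assoc)
        moreover have "0 < 1 + real n * x n * q n 1"
          using x_pos[of n] q_pos[of n 1] by (intro add_pos_nonneg) auto
        ultimately have "ln (1 + real n * x n * q n 1) \<le> ln (W n)"
          by (intro ln_mono) auto
        then show ?case
          using x_pos[of n] by (intro divide_right_mono) auto
      qed
      show "eventually (\<lambda>n. ln (W n) / (real n * x n) \<le> 1) sequentially"
        using W_le_exp eventually_gt_at_top[of 0]
      proof eventually_elim
        case (elim n)
        then have "ln (W n) \<le> real n * x n"
          using W_ge[of n] ln_mono[of "W n" "exp (real n * x n)"] by simp
        with elim x_pos[of n] show ?case by simp
      qed
    qed simp
    moreover have "eventually (\<lambda>n. ln (Z n) / (real n ^ 2 * x n) = ln (W n) / (real n * x n))
        sequentially"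
      using eventually_gt_at_top[of 0]
    proof eventually_elim
      case (elim n)
      with W_ge[of n] show ?case
        by (simp add: Z_eq ln_realpow power2_eq_square)
    qed
    ultimately show ?thesis by (simp add: filterlim_cong)
  qed
  ultimately show ?thesis
    unfolding x_def by blast
qed

end
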